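(* Let $L$ be the free modular lattice $FM(3)$ on three generators, let $\mathbb{K} = (\mathcal{J}(L), \mathcal{M}(L), \leq)$ be its standard context, and let $d = \dim(L)$ be the order dimension of $L$. Then $L$ does not have a $d$-dimensional line diagram that is both realizer-embedded and additive, i.e., $$\mathrm{reLD}^d(L) \cap \mathrm{AddLD}^d(\mathbb{K}) = \emptyset .$$
   Context: **Lattices and contexts.** $FM(3)$ is the modular lattice freely generated by three elements (finite; no additional bounds are adjoined). For a finite lattice $L$, $\mathcal{J}(L)$ is the set of join-irreducible elements ($c > \bigvee\{\tilde c \mid \tilde c < c\}$) and $\mathcal{M}(L)$ is the set of meet-irreducible elements ($c < \bigwedge\{\tilde c \mid \tilde c > c\}$). The standard context is $\mathbb{K} = (G,M,I) = (\mathcal{J}(L), \mathcal{M}(L), \leq)$, where $G$ and $M$ are treated as disjoint sets (an element that is both join- and meet-irreducible occurs once in each). The concept lattice $\underline{\mathfrak{B}}(\mathbb{K})$ is isomorphic to $L$, where $x \in L$ corresponds to the formal concept $(A_x, B_x)$ with extent $A_x = \{j \in \mathcal{J}(L) \mid j \leq x\}$ and intent $B_x = \{m \in \mathcal{M}(L) \mid x \leq m\}$. We identify $L$ with $\underline{\mathfrak{B}}(\mathbb{K})$ in this way. **Line diagrams in dimension $d$.** Write $u \prec v$ if $v$ covers $u$ in $L$. The set of $d$-dimensional line diagrams of $L$ is $$\mathrm{LD}^d(L) = \{\mathrm{pos} \colon L \to \mathbb{R}^d \mid \forall u,v \in L \colon u \prec v \Rightarrow \mathrm{pos}(u)_d <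 \mathrm{pos}(v)_d\},$$ where the subscript $d$ denotes the last coordinate. **Additive diagrams.** "Additive" means doubly-additive: $\mathrm{AddLD}^d(\mathbb{K})$ is the set of all $\mathrm{pos} \in \mathrm{LD}^d(\underline{\mathfrak{B}}(\mathbb{K}))$ for which there is a map $\mathrm{vec} \colon G \,\dot\cup\, M \to \mathbb{R}^d$ such that for every formal concept $(A,B)$ of $\mathbb{K}$ $$\mathrm{pos}(A,B) = \sum_{s \in A \cup (M \setminus B)} \mathrm{vec}(s).$$ **Realizer-embedded diagrams.** A linear extension of a finite ordered set $(P,\leq)$ is a strict total order $<_i$ on $P$ such that $p < q$ implies $p <_i q$. A set of linear extensions is a realizer if their intersection equals $<$. The order dimension $\dim(P)$ is the minimal cardinality of a realizer. For a linear extension $<_i$, let $\mathrm{pos}(c)_{<_i}$ denote the position of $c$ in $<_i$, counted from $0$, i.e. the number of elements $p$ with $p <_i c$ (so the positions range over $0, \dots, |P|-1$). For $d = \dim(L)$, a $d$-dimensional line diagram of $L$ is realizer-embedded if there is a realizer $\{<_1, \dots, <_d\}$ of $L$ with $\mathrm{pos}(c) = (\mathrm{pos}(c)_{<_1}, \dots, \mathrm{pos}(c)_{<_d})$ for all $c \in L$. The set of these diagrams is $\mathrm{reLD}^d(L) \subseteq \mathrm{LD}^d(L)$. *)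

theory Defs
  imports Complex_Main "HOL-Library.FuncSet" "HOL-Library.Lub_Glb"
begin

section \<open>Free modular lattices\<close>

class modular_lattice = lattice +
  assumes modular: "x \<le> z \<Longrightarrow> sup x (inf y z) = inf (sup x y) z"

datatype 'g lat_term =
  Gen 'g
| Meet "'g lat_term" "'g lat_term"
| Join "'g lat_term" "'g lat_term"

text \<open>
  Two terms are identified iff their equality follows from the identities of modular lattices.
  The modular law is used in its equational form
  \<open>(x \<and> z) \<or> (y \<and> z) = ((x \<and> z) \<or> y) \<and> z\<close>.
\<close>

inductive mod_eq :: "'g lat_term \<Rightarrow> 'g lat_term \<Rightarrow> bool" where
  refl: "mod_eq s s"
| sym: "mod_eq s t \<Longrightarrow> mod_eq t s"
| trans: "mod_eq s t \<Longrightarrow> mod_eq t u \<Longrightarrow> mod_eq s u"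
| cong_meet: "mod_eq s s' \<Longrightarrow> mod_eq t t' \<Longrightarrow> mod_eq (Meet s t) (Meet s' t')"
| cong_join: "mod_eq s s' \<Longrightarrow> mod_eq t t' \<Longrightarrow> mod_eq (Join s t) (Join s' t')"
| comm_meet: "mod_eq (Meet s t) (Meet t s)"
| comm_join: "mod_eq (Join s t) (Join t s)"
| assoc_meet: "mod_eq (Meet (Meet s t) u) (Meet s (Meet t u))"
| assoc_join: "mod_eq (Join (Join s t) u) (Join s (Join t u))"
| absorb_meet: "mod_eq (Meet s (Join s t)) s"
| absorb_join: "mod_eq (Join s (Meet s t)) s"
| modular_law: "mod_eq (Join (Meet s u) (Meet t u)) (Meet (Join (Meet s u) t) u)"

lemma equivp_mod_eq: "equivp mod_eq"
  by (intro equivpI reflpI sympI transpI) (blast intro: mod_eq.intros)+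

quotient_type 'g free_modular_lattice = "'g lat_term" / mod_eq
  by (rule equivp_mod_eq)

lift_definition fml_gen :: "'g \<Rightarrow> 'g free_modular_lattice" is Gen .

instantiation free_modular_lattice :: (type) modular_lattice
begin

lift_definition inf_free_modular_lattice ::
  "'a free_modular_lattice \<Rightarrow> 'a free_modular_lattice \<Rightarrow> 'a free_modular_lattice" is Meet
  by (rule mod_eq.cong_meet)

lift_definition sup_free_modular_lattice ::
  "'a free_modular_lattice \<Rightarrow> 'a free_modular_lattice \<Rightarrow> 'a free_modular_lattice" is Join
  by (rule mod_eq.cong_join)

definition less_eq_free_modular_lattice ::
  "'a free_modular_lattice \<Rightarrow> 'a free_modular_lattice \<Rightarrow> bool" where
  "less_eq_free_modular_lattice x y \<longleftrightarrow> inf x y = x"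

definition less_free_modular_lattice ::
  "'a free_modular_lattice \<Rightarrow> 'a free_modular_lattice \<Rightarrow> bool" where
  "less_free_modular_lattice x y \<longleftrightarrow> x \<le> y \<and> x \<noteq> y"

instance
proof -
  have mc: "inf x y = inf y x" for x y :: "'a free_modular_lattice"
    by transfer (rule mod_eq.comm_meet)
  have jc: "sup x y = sup y x" for x y :: "'a free_modular_lattice"
    by transfer (rule mod_eq.comm_join)
  have ma: "inf (inf x y) z = inf x (inf y z)" for x y z :: "'a free_modular_lattice"
    by transfer (rule mod_eq.assoc_meet)
  have ja: "sup (sup x y) z = sup x (sup y z)" for x y z :: "'a free_modular_lattice"
    by transfer (rule mod_eq.assoc_join)
  have mb: "inf x (sup x y) = x" for x y :: "'a free_modular_lattice"
    by transfer (rule mod_eq.absorb_meet)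
  have jb: "sup x (inf x y) = x" for x y :: "'a free_modular_lattice"
    by transfer (rule mod_eq.absorb_join)
  have ml: "sup (inf x z) (inf y z) = inf (sup (inf x z) y) z"
    for x y z :: "'a free_modular_lattice"
    by transfer (rule mod_eq.modular_law)
  have idem: "inf x x = x" for x :: "'a free_modular_lattice"
    by (metis mb jb)
  note le = less_eq_free_modular_lattice_def
  have le_sup: "x \<le> y \<longleftrightarrow> sup x y = y" for x y :: "'a free_modular_lattice"
    unfolding le by (metis mb jb mc jc)
  show "OFCLASS('a free_modular_lattice, modular_lattice_class)"
  proof
    fix x y z :: "'a free_modular_lattice"
    show "(x < y) = (x \<le> y \<and> \<not> y \<le> x)"
      unfolding less_free_modular_lattice_def le by (metis mc idem)
    show "x \<le> x" by (simp add: le idem)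
    show "x \<le> z" if "x \<le> y" "y \<le> z" using that unfolding le by (metis ma)
    show "x = y" if "x \<le> y" "y \<le> x" using that unfolding le by (metis mc)
    show "inf x y \<le> x" unfolding le by (metis ma mc idem)
    show "inf x y \<le> y" unfolding le by (metis ma idem)
    show "x \<le> inf y z" if "x \<le> y" "x \<le> z" using that unfolding le by (metis ma)
    show "x \<le> sup x y" unfolding le by (rule mb)
    show "y \<le> sup x y" unfolding le by (metis mb jc)
    show "sup y z \<le> x" if "y \<le> x" "z \<le> x" using that unfolding le_sup by (metis ja)
    show "sup x (inf y z) = inf (sup x y) z" if "x \<le> z"
      using that ml[of x z y] unfolding le by simp
  qed
qed

end

primrec lat_eval :: "('g \<Rightarrow> 'a::lattice) \<Rightarrow> 'g lat_term \<Rightarrow> 'a" where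
  "lat_eval f (Gen g) = f g"
| "lat_eval f (Meet s t) = inf (lat_eval f s) (lat_eval f t)"
| "lat_eval f (Join s t) = sup (lat_eval f s) (lat_eval f t)"

lemma lat_eval_mod_eq:
  fixes f :: "'g \<Rightarrow> 'a::modular_lattice"
  shows "mod_eq s t \<Longrightarrow> lat_eval f s = lat_eval f t"
proof (induction rule: mod_eq.induct)
  case (modular_law s u t)
  show ?case
    using modular[of "inf (lat_eval f s) (lat_eval f u)" "lat_eval f u" "lat_eval f t"] by simp
qed (simp_all add: ac_simps)

text \<open>The universal property of the free modular lattice.\<close>

theorem free_modular_lattice_universal:
  fixes f :: "'g \<Rightarrow> 'a::modular_lattice"
  shows "\<exists>!h. (\<forall>x y. h (inf x y) = inf (h x) (h y)) \<and> (\<forall>x y. h (sup x y) = sup (h x) (h y)) \<and>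
    (\<forall>g. h (fml_gen g) = f g)"
proof (rule ex1I)
  define h where "h x = lat_eval f (rep_free_modular_lattice x)" for x
  have h: "h (abs_free_modular_lattice t) = lat_eval f t" for t
    unfolding h_def
    by (rule lat_eval_mod_eq)
      (meson Quotient_free_modular_lattice Quotient_rep_abs mod_eq.refl)
  have inf: "h (inf x y) = inf (h x) (h y)" for x y
    by (induction x; induction y) (simp add: inf_free_modular_lattice.abs_eq h)
  have sup: "h (sup x y) = sup (h x) (h y)" for x y
    by (induction x; induction y) (simp add: sup_free_modular_lattice.abs_eq h)
  show "(\<forall>x y. h (inf x y) = inf (h x) (h y)) \<and> (\<forall>x y. h (sup x y) = sup (h x) (h y)) \<and>
    (\<forall>g. h (fml_gen g) = f g)"
    using inf sup by (simp add: fml_gen.abs_eq h)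
  fix k
  assume k: "(\<forall>x y. k (inf x y) = inf (k x) (k y)) \<and> (\<forall>x y. k (sup x y) = sup (k x) (k y)) \<and>
    (\<forall>g. k (fml_gen g) = f g)"
  have "k (abs_free_modular_lattice t) = lat_eval f t" for t
    by (induction t)
      (use k in \<open>simp_all flip: fml_gen.abs_eq inf_free_modular_lattice.abs_eq
        sup_free_modular_lattice.abs_eq\<close>)
  then have "k x = h x" for x
    by (induction x) (simp add: h)
  then show "k = h" ..
qed

datatype three_gens = GenX | GenY | GenZ

type_synonym fm3 = "three_gens free_modular_lattice"


section \<open>Standard contexts and concepts\<close>

text \<open>
  The join over the empty set is the least element, which is therefore not join-irreducible;
  dually for the greatest element.
\<close>

definition join_irreducibles :: "'a::lattice set" where
  "join_irreducibles = {c. \<exists>s. isLub UNIV {x. x < c} s \<and> s < c}"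

definition meet_irreducibles :: "'a::lattice set" where
  "meet_irreducibles = {c. \<exists>s. isGlb UNIV {x. x > c} s \<and> c < s}"

definition intent_of :: "'m set \<Rightarrow> ('g \<Rightarrow> 'm \<Rightarrow> bool) \<Rightarrow> 'g set \<Rightarrow> 'm set" where
  "intent_of M I A = {m \<in> M. \<forall>g\<in>A. I g m}"

definition extent_of :: "'g set \<Rightarrow> ('g \<Rightarrow> 'm \<Rightarrow> bool) \<Rightarrow> 'm set \<Rightarrow> 'g set" where
  "extent_of G I B = {g \<in> G. \<forall>m\<in>B. I g m}"

definition concepts :: "'g set \<Rightarrow> 'm set \<Rightarrow> ('g \<Rightarrow> 'm \<Rightarrow> bool) \<Rightarrow> ('g set \<times> 'm set) set" where
  "concepts G M I =
    {(A, B). A \<subseteq> G \<and> B \<subseteq> M \<and> intent_of M I A = B \<and> extent_of G I B = A}"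

definition concept_le :: "'g set \<times> 'm set \<Rightarrow> 'g set \<times> 'm set \<Rightarrow> bool" where
  "concept_le C D \<longleftrightarrow> fst C \<subseteq> fst D"

text \<open>The identification of a finite lattice with the concept lattice of its standard context.\<close>

definition concept_of :: "'a::lattice \<Rightarrow> 'a set \<times> 'a set" where
  "concept_of x = ({j \<in> join_irreducibles. j \<le> x}, {m \<in> meet_irreducibles. x \<le> m})"


section \<open>Line diagrams\<close>

text \<open>
  An ordered set is given by its carrier \<open>P\<close> and its order relation \<open>le\<close>. Points of
  $d$-dimensional space are extensional functions on \<open>{..<d}\<close>, so that the last coordinate,
  for \<open>d > 0\<close>, has index \<open>d - 1\<close>.
\<close>

definition covered_by :: "'a set \<Rightarrow> ('a \<Rightarrow> 'a \<Rightarrow> bool) \<Rightarrow> 'a \<Rightarrow> 'a \<Rightarrow> bool" where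
  "covered_by P le u v \<longleftrightarrow> u \<in> P \<and> v \<in> P \<and> le u v \<and> u \<noteq> v \<and>
    \<not> (\<exists>w\<in>P. le u w \<and> u \<noteq> w \<and> le w v \<and> w \<noteq> v)"

definition points :: "nat \<Rightarrow> (nat \<Rightarrow> real) set" where
  "points d = {..<d} \<rightarrow>\<^sub>E UNIV"

definition LD :: "nat \<Rightarrow> 'a set \<Rightarrow> ('a \<Rightarrow> 'a \<Rightarrow> bool) \<Rightarrow> ('a \<Rightarrow> nat \<Rightarrow> real) set" where
  "LD d P le = {pos \<in> P \<rightarrow>\<^sub>E points d.
    \<forall>u v. covered_by P le u v \<longrightarrow> pos u (d - 1) < pos v (d - 1)}"

text \<open>
  The disjoint union of objects and attributes is the sum \<open>G <+> M\<close>, so that an element of the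
  lattice occurring in both sets receives two vectors. For finite contexts only, as the sum over
  an infinite set is 0.
\<close>

definition AddLD ::
  "nat \<Rightarrow> 'g set \<Rightarrow> 'm set \<Rightarrow> ('g \<Rightarrow> 'm \<Rightarrow> bool) \<Rightarrow> ('g set \<times> 'm set \<Rightarrow> nat \<Rightarrow> real) set" where
  "AddLD d G M I = {pos \<in> LD d (concepts G M I) concept_le.
    \<exists>vec \<in> (G <+> M) \<rightarrow> points d. \<forall>(A, B) \<in> concepts G M I. \<forall>i<d.
      pos (A, B) i = (\<Sum>s \<in> A <+> (M - B). vec s i)}"

definition linear_extension :: "'a set \<Rightarrow> ('a \<Rightarrow> 'a \<Rightarrow> bool) \<Rightarrow> 'a rel \<Rightarrow> bool" where
  "linear_extension P le r \<longleftrightarrow> r \<subseteq> P \<times> P \<and> strict_linear_order_on P r \<and>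
    (\<forall>p\<in>P. \<forall>q\<in>P. le p q \<and> p \<noteq> q \<longrightarrow> (p, q) \<in> r)"

definition realizer :: "'a set \<Rightarrow> ('a \<Rightarrow> 'a \<Rightarrow> bool) \<Rightarrow> 'a rel set \<Rightarrow> bool" where
  "realizer P le R \<longleftrightarrow> (\<forall>r\<in>R. linear_extension P le r) \<and>
    \<Inter>R = {(p, q). p \<in> P \<and> q \<in> P \<and> le p q \<and> p \<noteq> q}"

definition order_dim :: "'a set \<Rightarrow> ('a \<Rightarrow> 'a \<Rightarrow> bool) \<Rightarrow> nat" where
  "order_dim P le = (LEAST n. \<exists>R. realizer P le R \<and> finite R \<and> card R = n)"

definition ext_position :: "'a rel \<Rightarrow> 'a \<Rightarrow> nat" where
  "ext_position r c = card {p. (p, c) \<in> r}"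

definition reLD :: "nat \<Rightarrow> 'a set \<Rightarrow> ('a \<Rightarrow> 'a \<Rightarrow> bool) \<Rightarrow> ('a \<Rightarrow> nat \<Rightarrow> real) set" where
  "reLD d P le = {pos \<in> LD d P le.
    \<exists>rs :: nat \<Rightarrow> 'a rel. realizer P le (rs ` {..<d}) \<and>
      (\<forall>c\<in>P. \<forall>i<d. pos c i = real (ext_position (rs i) c))}"

end

theory Submission
  imports Defs
begin

text \<open>
  Already a single coordinate is impossible. An additive function \<open>F\<close> on the lattice satisfies
  \<open>F (x \<or> y) + F (x \<and> y) = F x + F y\<close> whenever all elements distribute over \<open>x \<or> y\<close> and \<open>x \<and> y\<close>,
  and in the free modular lattice on three generators this holds if the images of \<open>x\<close> and \<open>y\<close> in the
  five-element quotient \<open>M\<^sub>3\<close> are comparable. The fibre over the bottom of \<open>M\<^sub>3\<close> is a cube with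
  three steps \<open>p\<close>, the fibre over the top is a cube with three steps \<open>q\<close>, and the fibre over each atom
  is a square whose steps are one \<open>p\<close> and the corresponding \<open>q\<close>. If \<open>F\<close> is the position in a linear
  extension, the values on these cubes and squares partition \<open>{0..27}\<close>, with the lower cube starting
  at 0 and the upper one ending at 27. A finite search shows that there is no such partition.
\<close>

section \<open>Tilings of an interval by cubes and squares\<close>

definition tile :: "int \<Rightarrow> int \<Rightarrow> int \<Rightarrow> int list" where
  "tile p q s = [s, s + p, s + q, s + p + q]"

definition cube :: "int \<Rightarrow> int \<Rightarrow> int \<Rightarrow> int list" where
  "cube a b c = tile a b 0 @ tile a b c"

definition tiling :: "int \<times> int \<times> int \<Rightarrow> int \<times> int \<times> int \<Rightarrow> int \<times> int \<times> int \<Rightarrow> int list" where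
  "tiling = (\<lambda>(p1, p2, p3) (q1, q2, q3) (s1, s2, s3).
    cube p1 p2 p3 @ map (\<lambda>v. 27 - v) (cube q1 q2 q3) @ tile p1 q1 s1 @ tile p2 q2 s2 @ tile p3 q3 s3)"

definition fits :: "int list \<Rightarrow> int \<Rightarrow> int \<Rightarrow> int \<Rightarrow> bool" where
  "fits used p q s \<longleftrightarrow> p \<noteq> q \<and> list_all (\<lambda>v. \<not> List.member used v) (tile p q s)"

text \<open>
  Of the three steps in each of the two cubes, one is 1 and one is 2, as the values 1, 2, 25 and 26
  are not available elsewhere; \<open>p\<close> and \<open>q\<close> are the remaining ones. The bounds of the search keep
  the tiles between the elements that lie below and above them in the lattice.
\<close>

definition tilable :: "int \<Rightarrow> int \<Rightarrow> int \<Rightarrow> int \<Rightarrow> int \<Rightarrow> bool" where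
  "tilable p q q1 q2 q3 \<longleftrightarrow>
    (let used = cube 1 2 p @ map (\<lambda>v. 27 - v) (cube 1 2 q) in
     list_ex (\<lambda>s3. fits used p q3 s3 \<and>
       (let used3 = tile p q3 s3 @ used in
        list_ex (\<lambda>s2. fits used3 2 q2 s2 \<and>
          (let used2 = tile 2 q2 s2 @ used3 in
           list_ex (\<lambda>s1. fits used2 1 q1 s1) [p+3..22-q]))
         [p+2..21-q]))
      [4..23-p-q])"

text \<open>The three orders are the permutations of 1, 2, \<open>q\<close> whose first entry
  differs from 1 and whose second differs from 2, as the two steps of a square must differ. Only
  finitely many \<open>p\<close> and \<open>q\<close> remain, so evaluation decides the
  claim.\<close>

lemma not_tilable:
  assumes "4 \<le> p" "4 \<le> q" "p + q \<le> 20"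
  shows "\<not> tilable p q 2 1 q" "\<not> tilable p q 2 q 1" "\<not> tilable p q q 1 2"
proof -
  have *: "list_all (\<lambda>p. list_all (\<lambda>q. \<not> tilable p q 2 1 q \<and> \<not> tilable p q 2 q 1 \<and> \<not> tilable p q q 1 2)
      [4..20-p]) [4..16]"
    by code_simp
  have "p \<in> set [4..16]" "q \<in> set [4..20-p]"
    unfolding set_upto using assms by auto
  with * show "\<not> tilable p q 2 1 q" "\<not> tilable p q 2 q 1" "\<not> tilable p q q 1 2"
    unfolding list_all_iff by blast+
qed

text \<open>Pigeonhole: the list has 8 + 8 + 3 * 4 = 28 entries, exactly as many as there are values
  to cover.\<close>

lemma distinct_tiling:
  assumes "{0..27} \<subseteq> set (tiling p q s)"
  shows "distinct (tiling p q s)"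
proof (rule card_distinct)
  have "length (tiling p q s) = 28"
    by (cases p; cases q; cases s) (simp add: tiling_def cube_def tile_def)
  then show "card (set (tiling p q s)) = length (tiling p q s)"
    using card_mono[OF _ assms] card_length[of "tiling p q s"] by simp
qed

lemma no_tiling_sorted:
  assumes cov: "{0..27} \<subseteq> set (tiling (p1, p2, p3) (q1, q2, q3) (s1, s2, s3))"
    and p: "0 < p1" "p1 < p2" "p2 < p3" and q: "0 < q1" "0 < q2" "0 < q3"
    and s: "p2 + p3 < s1" "p1 + p3 < s2" "p1 + p2 < s3"
    and t: "s1 + p1 < 27 - q1 - q2 - q3" "s2 + p2 < 27 - q1 - q2 - q3" "s3 + p3 < 27 - q1 - q2 - q3"
  shows False
proof -
  let ?L = "tiling (p1, p2, p3) (q1, q2, q3) (s1, s2, s3)"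
  note defs = tiling_def cube_def tile_def
  have dist: "distinct ?L"
    by (rule distinct_tiling[OF cov])
  have c: "v \<in> set ?L" if "0 \<le> v" "v \<le> 27" for v
    using cov that by auto
  \<comment> \<open>The squares and the upper cube start above 2, so 1 and 2 are subset sums of the
    \<open>p\<close> steps; in sorted order they can only be \<open>p1\<close> and
    \<open>p2\<close>.\<close>
  have p1: "p1 = 1"
    using c[of 1] p q s t by (auto simp: defs)
  have p2: "p2 = 2"
    using c[of 2] p q s t p1 by (auto simp: defs)
  have dc: "distinct (cube p1 p2 p3)" "distinct (cube q1 q2 q3)"
    using dist by (simp_all add: tiling_def distinct_map)
  have dt: "distinct (tile p1 q1 s1)" "distinct (tile p2 q2 s2)" "distinct (tile p3 q3 s3)"
    using dist by (simp_all add: tiling_def)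
  have neq: "p1 \<noteq> q1" "p2 \<noteq> q2" "p3 \<noteq> q3"
    using dt by (simp_all add: tile_def)
  have qs: "q1 \<noteq> q2" "q1 \<noteq> q3" "q2 \<noteq> q3" "q1 + q2 \<noteq> q3" "q1 + q3 \<noteq> q2" "q2 + q3 \<noteq> q1"
    using dc(2) by (auto simp: cube_def tile_def)
  \<comment> \<open>The top corner \<open>s1 + p1 + q1\<close> of a square is below
    \<open>27 - q2 - q3\<close>, hence at most 24, and likewise for the other squares. So 26 and 25
    must come from the upper cube.\<close>
  have one: "q1 = 1 \<or> q2 = 1 \<or> q3 = 1"
    using c[of 26] p q s t by (auto simp: defs)
  have two: "q1 = 2 \<or> q2 = 2 \<or> q3 = 2"
    using c[of 25] p q s t one qs by (auto simp: defs)
  \<comment> \<open>The value 3 is already taken by \<open>p1 + p2\<close>.\<close>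
  have "p3 \<noteq> 3"
    using dc(1) p1 p2 by (auto simp: cube_def tile_def)
  then have p3: "4 \<le> p3"
    using p p2 by linarith
  \<comment> \<open>\<open>q'\<close> is the step of the upper cube besides 1 and 2; unequal steps
    within each square leave three orders.\<close>
  define q' where "q' = q1 + q2 + q3 - 3"
  have cs: "q1 = 2 \<and> q2 = 1 \<and> q3 = q' \<or> q1 = 2 \<and> q2 = q' \<and> q3 = 1 \<or> q1 = q' \<and> q2 = 1 \<and> q3 = 2"
    using one two neq qs p1 p2 by (auto simp: q'_def)
  have "q' \<noteq> 3" "q' \<noteq> 1" "q' \<noteq> 2" "0 < q'"
    using cs qs q by auto
  then have q': "4 \<le> q'" by linarith
  have up: "set (cube q1 q2 q3) = set (cube 1 2 q')"
    using cs by (auto simp: cube_def tile_def)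
  have fitsI: "fits used a b s" if "a \<noteq> b" "set (tile a b s) \<inter> set used = {}" for used a b s
    using that by (auto simp: fits_def list_all_iff)
  let ?C = "set (cube p1 p2 p3) \<union> (\<lambda>v. 27 - v) ` set (cube q1 q2 q3)"
  have disj: "set (tile p3 q3 s3) \<inter> ?C = {}"
    "set (tile p2 q2 s2) \<inter> (set (tile p3 q3 s3) \<union> ?C) = {}"
    "set (tile p1 q1 s1) \<inter> (set (tile p2 q2 s2) \<union> (set (tile p3 q3 s3) \<union> ?C)) = {}"
    using dist by (auto simp: tiling_def)
  have "q1 + q2 + q3 = q' + 3"
    by (simp add: q'_def)
  then have sb: "s3 \<in> set [4..23-p3-q']" "s2 \<in> set [p3+2..21-q']" "s1 \<in> set [p3+3..22-q']"
    unfolding set_upto using s t p1 p2 by auto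
  have "tilable p3 q' q1 q2 q3"
    unfolding tilable_def Let_def list_ex_iff
    by (intro bexI[OF _ sb(1)] bexI[OF _ sb(2)] bexI[OF _ sb(3)] conjI fitsI)
      (use disj neq p1 p2 up in simp_all)
  moreover have "p3 + q' \<le> 20"
    using t(3) s p p1 p2 by (simp add: q'_def)
  ultimately show False
    using not_tilable[of p3 q'] cs p3 q' by auto
qed

lemma set_cube_permute: "set (cube b a c) = set (cube a b c)" "set (cube a c b) = set (cube a b c)"
  by (auto simp: cube_def tile_def)

text \<open>Distinctness makes the \<open>p\<close> steps different, and permuting the indices of
  \<open>p\<close>, \<open>q\<close> and \<open>s\<close> simultaneously preserves the covered set
  and the bounds, so the \<open>p\<close> steps may be sorted.\<close>

lemma no_tiling:
  assumes cov: "{0..27} \<subseteq> set (tiling (p1, p2, p3) (q1, q2, q3) (s1, s2, s3))"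
    and p: "0 < p1" "0 < p2" "0 < p3" and q: "0 < q1" "0 < q2" "0 < q3"
    and s: "p2 + p3 < s1" "p1 + p3 < s2" "p1 + p2 < s3"
    and t: "s1 + p1 < 27 - q1 - q2 - q3" "s2 + p2 < 27 - q1 - q2 - q3" "s3 + p3 < 27 - q1 - q2 - q3"
  shows False
proof -
  have "distinct (cube p1 p2 p3)"
    using distinct_tiling[OF cov] by (simp add: tiling_def)
  then have "p1 \<noteq> p2" "p1 \<noteq> p3" "p2 \<noteq> p3"
    by (auto simp: cube_def tile_def)
  then consider "p1 < p2" "p2 < p3" | "p1 < p3" "p3 < p2" | "p2 < p1" "p1 < p3"
    | "p2 < p3" "p3 < p1" | "p3 < p1" "p1 < p2" | "p3 < p2" "p2 < p1"
    by linarith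
  then show False
  proof cases
    case 1
    show ?thesis
      by (rule no_tiling_sorted[of p1 p2 p3 q1 q2 q3 s1 s2 s3])
        (use cov p q s t 1 in \<open>simp_all add: tiling_def set_cube_permute Un_ac\<close>)
  next
    case 2
    show ?thesis
      by (rule no_tiling_sorted[of p1 p3 p2 q1 q3 q2 s1 s3 s2])
        (use cov p q s t 2 in \<open>simp_all add: tiling_def set_cube_permute Un_ac\<close>)
  next
    case 3
    show ?thesis
      by (rule no_tiling_sorted[of p2 p1 p3 q2 q1 q3 s2 s1 s3])
        (use cov p q s t 3 in \<open>simp_all add: tiling_def set_cube_permute Un_ac\<close>)
  next
    case 4
    show ?thesis
      by (rule no_tiling_sorted[of p2 p3 p1 q2 q3 q1 s2 s3 s1])
        (use cov p q s t 4 in \<open>simp_all add: tiling_def set_cube_permute Un_ac\<close>)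
  next
    case 5
    show ?thesis
      by (rule no_tiling_sorted[of p3 p1 p2 q3 q1 q2 s3 s1 s2])
        (use cov p q s t 5 in \<open>simp_all add: tiling_def set_cube_permute Un_ac\<close>)
  next
    case 6
    show ?thesis
      by (rule no_tiling_sorted[of p3 p2 p1 q3 q2 q1 s3 s2 s1])
        (use cov p q s t 6 in \<open>simp_all add: tiling_def set_cube_permute Un_ac\<close>)
  qed
qed

section \<open>The elements of the free modular lattice on three generators\<close>

text \<open>An absent joinand is replaced by \<open>e\<close>, which lies below all joinands in use
  and so acts as a neutral element. In the dual reading \<open>e\<close> becomes the greatest
  element.\<close>

definition opt :: "'a \<Rightarrow> bool \<Rightarrow> 'a \<Rightarrow> 'a" where
  "opt e P v = (if P then v else e)"

lemma opt_simps [simp]: "opt e True v = v" "opt e False v = e"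
  by (simp_all add: opt_def)

context lattice
begin

lemma opt_le: "e \<le> w \<Longrightarrow> v \<le> w \<Longrightarrow> opt e P v \<le> w"
  by (simp add: opt_def)

text \<open>This rule turns joins of normal forms into disjunctions of their flags.\<close>

lemma opt_disj: "e \<le> v \<Longrightarrow> opt e (P \<or> Q) v = sup (opt e P v) (opt e Q v)"
  by (simp add: opt_def sup_absorb1 sup_absorb2)

text \<open>
  The free modular lattice on \<open>x\<close>, \<open>y\<close>, \<open>z\<close> consists of eight elements that are joins of the
  pairwise meets of generators, eight elements that are joins of the upper median with generators,
  and four elements for each generator \<open>x\<close>, namely \<open>x \<and> (y \<or> z)\<close> joined with any of \<open>y \<and> z\<close>
  and \<open>x\<close>. In this form the joins are easy to compute.
\<close>

definition low :: "'a \<Rightarrow> 'a \<Rightarrow> 'a \<Rightarrow> 'a \<Rightarrow> bool \<Rightarrow> bool \<Rightarrow> bool \<Rightarrow> 'a" where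
  "low e a b c P Q R = sup (opt e P a) (sup (opt e Q b) (opt e R c))"

definition mid :: "'a \<Rightarrow> 'a \<Rightarrow> 'a \<Rightarrow> 'a \<Rightarrow> bool \<Rightarrow> bool \<Rightarrow> 'a" where
  "mid e m a x P Q = sup m (sup (opt e P a) (opt e Q x))"

definition lows :: "'a \<Rightarrow> 'a \<Rightarrow> 'a \<Rightarrow> 'a \<Rightarrow> 'a set" where
  "lows e a b c = {low e a b c P Q R | P Q R. True}"

definition mids :: "'a \<Rightarrow> 'a \<Rightarrow> 'a \<Rightarrow> 'a \<Rightarrow> 'a set" where
  "mids e m a x = {mid e m a x P Q | P Q. True}"

lemma lows_permute: "lows e b a c = lows e a b c" "lows e a c b = lows e a b c"
proof -
  have "low e b a c P Q R = low e a b c Q P R" "low e a c b P Q R = low e a b c P R Q" for P Q R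
    by (simp_all add: low_def ac_simps)
  then show "lows e b a c = lows e a b c" "lows e a c b = lows e a b c"
    unfolding lows_def by (simp_all only:) blast+
qed

lemma lows_sup:
  assumes "e \<le> a" "e \<le> b" "e \<le> c" "u \<in> lows e a b c" "v \<in> lows e a b c"
  shows "sup u v \<in> lows e a b c"
proof -
  have "sup (low e a b c P Q R) (low e a b c P' Q' R') = low e a b c (P \<or> P') (Q \<or> Q') (R \<or> R')"
    for P Q R P' Q' R'
    using assms by (simp add: low_def opt_disj ac_simps)
  then show ?thesis
    using assms unfolding lows_def by blast
qed

lemma opt_in_lows:
  assumes "e \<le> a" "e \<le> b" "e \<le> c"
  shows "opt e P a \<in> lows e a b c" "opt e P b \<in> lows e a b c" "opt e P c \<in> lows e a b c"
proof -
  have "opt e P a = low e a b c P False False" "opt e P b = low e a b c False P False"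
    "opt e P c = low e a b c False False P"
    using assms by (simp_all add: low_def opt_def sup_absorb1 sup_absorb2)
  then show "opt e P a \<in> lows e a b c" "opt e P b \<in> lows e a b c" "opt e P c \<in> lows e a b c"
    unfolding lows_def by blast+
qed

lemma lows_le:
  assumes "u \<in> lows e a b c" "e \<le> w" "a \<le> w" "b \<le> w" "c \<le> w"
  shows "u \<le> w"
  using assms by (auto simp: lows_def low_def opt_le)

text \<open>\<open>m\<close> absorbs \<open>b\<close> and \<open>c\<close>, so only the flag of
  \<open>a\<close> survives from the low element.\<close>

lemma sup_lows_mids:
  assumes "e \<le> a" "e \<le> x" "e \<le> m" "b \<le> m" "c \<le> m" "u \<in> lows e a b c" "v \<in> mids e m a x"
  shows "sup u v \<in> mids e m a x"
proof -
  have "sup (low e a b c P Q R) (mid e m a x P' Q') = mid e m a x (P \<or> P') Q'" for P Q R P' Q'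
  proof -
    have "sup (opt e Q b) m = m" "sup (opt e R c) m = m"
      using assms by (meson opt_le sup_absorb2)+
    then have *: "sup (opt e Q b) (sup m w) = sup m w" "sup (opt e R c) (sup m w) = sup m w" for w
      by (simp_all flip: sup_assoc)
    have "sup (low e a b c P Q R) (mid e m a x P' Q') =
      sup (sup (opt e P a) (opt e P' a)) (sup (opt e Q b) (sup (opt e R c) (sup m (opt e Q' x))))"
      by (simp add: low_def mid_def ac_simps)
    also have "\<dots> = mid e m a x (P \<or> P') Q'"
      unfolding * using assms by (simp add: opt_disj mid_def ac_simps)
    finally show ?thesis .
  qed
  then show ?thesis
    using assms(6,7) unfolding lows_def mids_def by blast
qed

lemma mids_sup:
  assumes "e \<le> a" "e \<le> x" "u \<in> mids e m a x" "v \<in> mids e m a x"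
  shows "sup u v \<in> mids e m a x"
proof -
  have "sup (mid e m a x P Q) (mid e m a x P' Q') = mid e m a x (P \<or> P') (Q \<or> Q')" for P Q P' Q'
    using assms by (simp add: mid_def opt_disj ac_simps)
  then show ?thesis
    using assms unfolding mids_def by blast
qed

text \<open>The bottoms \<open>m\<close> and \<open>n\<close> of two different sides join to
  \<open>t\<close>, which absorbs \<open>a\<close> and \<open>b\<close> and leaves only the flags of
  the generators.\<close>

lemma sup_mids:
  assumes "sup m n = t" "a \<le> t" "b \<le> t" "e \<le> a" "e \<le> b" "u \<in> mids e m a x" "v \<in> mids e n b y"
  shows "\<exists>Q Q'. sup u v = sup t (sup (opt e Q x) (opt e Q' y))"
proof -
  have "sup (mid e m a x P Q) (mid e n b y P' Q') = sup t (sup (opt e Q x) (opt e Q' y))" for P Q P' Q'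
  proof -
    have "sup (opt e P a) t = t" "sup (opt e P' b) t = t"
      using assms by (meson opt_le sup_absorb2 order_trans)+
    then have *: "sup (opt e P a) (sup t w) = sup t w" "sup (opt e P' b) (sup t w) = sup t w" for w
      by (simp_all flip: sup_assoc)
    have "sup (mid e m a x P Q) (mid e n b y P' Q') =
      sup (opt e P a) (sup (opt e P' b) (sup (sup m n) (sup (opt e Q x) (opt e Q' y))))"
      by (simp add: mid_def ac_simps)
    then show ?thesis
      by (simp add: * assms(1))
  qed
  then show ?thesis
    using assms(6,7) unfolding mids_def by blast
qed

lemma sup_mids_above:
  assumes "m \<le> t" "a \<le> t" "e \<le> a" "u \<in> mids e m a x"
  shows "\<exists>Q. sup u (sup t w) = sup t (sup (opt e Q x) w)"
proof -
  have "sup (mid e m a x P Q) (sup t w) = sup t (sup (opt e Q x) w)" for P Q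
  proof -
    have "sup m (sup (opt e P a) t) = t"
      using assms by (metis opt_le sup_absorb2 order_trans)
    then have "sup (sup m (sup (opt e P a) t)) (sup (opt e Q x) w) = sup t (sup (opt e Q x) w)"
      by simp
    then show ?thesis
      by (simp add: mid_def ac_simps)
  qed
  then show ?thesis
    using assms(4) unfolding mids_def by blast
qed

text \<open>Intended reading: \<open>e\<close> is the bottom, \<open>t\<close> the upper median,
  \<open>a g\<close> the meet of the two generators other than \<open>x g\<close>, and
  \<open>m g\<close> the least element of the side of \<open>x g\<close>. With these as parameters,
  closure depends on a few relations only, and the definition can be read in the dual lattice as
  well.\<close>

definition fm_set :: "'a \<Rightarrow> 'a \<Rightarrow> (three_gens \<Rightarrow> 'a) \<Rightarrow> (three_gens \<Rightarrow> 'a) \<Rightarrow> (three_gens \<Rightarrow> 'a) \<Rightarrow> 'a set" where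
  "fm_set e t a m x = lows e (a GenX) (a GenY) (a GenZ) \<union> (\<Union>g. mids e (m g) (a g) (x g)) \<union>
    sup t ` lows e (x GenX) (x GenY) (x GenZ)"

text \<open>Elements of the same kind combine their flags. A low element adds at most one atom to a
  side, two different sides join above \<open>t\<close>, and \<open>t\<close> absorbs every low
  element and every side bottom.\<close>

lemma fm_set_sup_closed:
  assumes a: "\<And>g. e \<le> a g" and am: "\<And>g h. g \<noteq> h \<Longrightarrow> a h \<le> m g" and mx: "\<And>g. m g \<le> x g"
    and t: "\<And>g h. g \<noteq> h \<Longrightarrow> sup (m g) (m h) = t"
    and u: "u \<in> fm_set e t a m x" and v: "v \<in> fm_set e t a m x"
  shows "sup u v \<in> fm_set e t a m x"
proof -
  let ?l = "lows e (a GenX) (a GenY) (a GenZ)" and ?m = "\<lambda>g. mids e (m g) (a g) (x g)"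
    and ?u = "lows e (x GenX) (x GenY) (x GenZ)"
  have other: "\<exists>h. h \<noteq> g" for g :: three_gens
    by (cases g) blast+
  have em: "e \<le> m g" for g
    using other[of g] a am by (metis order_trans)
  have ex: "e \<le> x g" for g
    using em mx by (meson order_trans)
  have mt: "m g \<le> t" for g
    using other[of g] t by (metis sup_ge1)
  have at: "a g \<le> t" for g
    using other[of g] am mt by (metis order_trans)
  have et: "e \<le> t"
    using a at by (meson order_trans)
  have opt_up: "opt e Q (x g) \<in> ?u" for Q g
    using opt_in_lows[OF ex ex ex] by (cases g) auto
  have up_up: "sup (sup t p) (sup t q) \<in> sup t ` ?u" if "p \<in> ?u" "q \<in> ?u" for p q
  proof -
    have "sup (sup t p) (sup t q) = sup t (sup p q)" by (simp add: ac_simps)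
    then show ?thesis using lows_sup[OF ex ex ex that] by blast
  qed
  have low_mid: "sup p q \<in> ?m g" if "p \<in> ?l" "q \<in> ?m g" for p q g
  proof (cases g)
    case GenX
    show ?thesis
      using sup_lows_mids[OF a ex em am am _ that(2), of GenY GenZ] that(1) GenX by simp
  next
    case GenY
    show ?thesis
      using sup_lows_mids[OF a ex em am am _ that(2), of GenX GenZ] that(1) GenY by (simp add: lows_permute)
  next
    case GenZ
    show ?thesis
      using sup_lows_mids[OF a ex em am am _ that(2), of GenX GenY] that(1) GenZ by (simp add: lows_permute)
  qed
  have low_up: "sup p (sup t q) \<in> sup t ` ?u" if "p \<in> ?l" "q \<in> ?u" for p q
  proof -
    have "sup p t = t"
      using lows_le[OF that(1) et at at at] by (rule sup_absorb2)
    then have "sup p (sup t q) = sup t q" by (simp flip: sup_assoc)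
    then show ?thesis using that by simp
  qed
  have mid_mid: "sup p q \<in> ?m g \<union> sup t ` ?u" if pq: "p \<in> ?m g" "q \<in> ?m h" for p q g h
  proof (cases "g = h")
    case True
    then show ?thesis using mids_sup[OF a ex] pq by blast
  next
    case False
    then obtain Q Q' where "sup p q = sup t (sup (opt e Q (x g)) (opt e Q' (x h)))"
      using sup_mids[OF t at at a a pq] by blast
    then show ?thesis using lows_sup[OF ex ex ex opt_up opt_up] by simp
  qed
  have mid_up: "sup p (sup t q) \<in> sup t ` ?u" if pq: "p \<in> ?m g" "q \<in> ?u" for p q g
  proof -
    obtain Q where "sup p (sup t q) = sup t (sup (opt e Q (x g)) q)"
      using sup_mids_above[OF mt at a pq(1)] by blast
    then show ?thesis using lows_sup[OF ex ex ex opt_up pq(2)] by simp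
  qed
  let ?S = "fm_set e t a m x"
  have S: "p \<in> ?l \<Longrightarrow> p \<in> ?S" "p \<in> ?m g \<Longrightarrow> p \<in> ?S" "p \<in> sup t ` ?u \<Longrightarrow> p \<in> ?S" for p g
    by (auto simp: fm_set_def)
  have split: thesis
    if "p \<in> ?S" "p \<in> ?l \<Longrightarrow> thesis" "\<And>g. p \<in> ?m g \<Longrightarrow> thesis"
      "\<And>q. p = sup t q \<Longrightarrow> q \<in> ?u \<Longrightarrow> thesis" for p thesis
    using that by (auto simp: fm_set_def)
  show ?thesis
  proof (rule split[OF u])
    assume l: "u \<in> ?l"
    show ?thesis
      by (rule split[OF v])
        (use l in \<open>simp_all add: S(1)[OF lows_sup[OF a a a]] S(2)[OF low_mid] S(3)[OF low_up]\<close>)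
  next
    fix g
    assume m: "u \<in> ?m g"
    show ?thesis
    proof (rule split[OF v])
      assume "v \<in> ?l"
      then show ?thesis
        by (subst sup_commute) (rule S(2)[OF low_mid[OF _ m]])
    next
      fix h
      assume "v \<in> ?m h"
      from mid_mid[OF m this] show ?thesis
        using S(2,3) by (elim UnE)
    next
      fix q
      assume "v = sup t q" "q \<in> ?u"
      then show ?thesis
        using S(3)[OF mid_up[OF m]] by simp
    qed
  next
    fix p
    assume p: "u = sup t p" "p \<in> ?u"
    show ?thesis
    proof (rule split[OF v])
      assume "v \<in> ?l"
      then show ?thesis
        unfolding p(1) by (subst sup_commute) (rule S(3)[OF low_up[OF _ p(2)]])
    next
      fix h
      assume "v \<in> ?m h"
      then show ?thesis
        unfolding p(1) by (subst sup_commute) (rule S(3)[OF mid_up[OF _ p(2)]])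
    next
      fix q
      assume "v = sup t q" "q \<in> ?u"
      then show ?thesis
        using S(3)[OF up_up[OF p(2)]] p by simp
    qed
  qed
qed

end

section \<open>Self-duality of the normal forms\<close>

lemma image_Collect3: "f ` {F P Q R | P Q R. True} = {f (F P Q R) | P Q R. True}"
  by blast

text \<open>Negation permutes the flag triples. Duality calls for this, as a factor of a meet is
  present exactly when the complementary joinand is absent.\<close>

lemma Collect_neg3: "{F (\<not> P) (\<not> Q) (\<not> R) | P Q R. True} = {F P Q R | P Q R. True}"
  by (rule Collect_cong) (simp only: ex_bool_eq simp_thms disj_ac)

lemma Collect_neg_swap: "{F (\<not> Q) (\<not> P) | P Q. True} = {F P Q | P Q. True}"
  by (rule Collect_cong) (simp only: ex_bool_eq simp_thms disj_ac)

context modular_lattice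
begin

lemma dual_modular: "class.modular_lattice sup (\<ge>) (>) inf"
proof (intro class.modular_lattice.intro dual_lattice class.modular_lattice_axioms.intro)
  fix x z y :: 'a
  assume "x \<ge> z"
  then show "inf x (sup y z) = sup (inf x y) z"
    using modular[of z x y] by (simp only: inf_commute sup_commute)
qed

interpretation dual: modular_lattice sup "(\<ge>)" "(>)" inf
  by (fact dual_modular)

lemma modular_sup: "x \<le> z \<Longrightarrow> inf (sup x y) z = sup x (inf y z)"
  by (simp add: modular)

text \<open>The modular law applies twice, to \<open>inf x (sup y z) \<le> sup x z\<close> and to
  \<open>y \<le> sup y z\<close>. The result is symmetric in the generators, so any two side bottoms
  have the same join.\<close>

lemma sup_middle:
  "sup (inf x (sup y z)) (inf y (sup x z)) = inf (sup x y) (inf (sup x z) (sup y z))"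
proof -
  have "sup (inf x (sup y z)) (inf y (sup x z)) = inf (sup (inf x (sup y z)) y) (sup x z)"
    by (rule modular) (simp add: le_infI1)
  also have "sup (inf x (sup y z)) y = inf (sup y x) (sup y z)"
    using modular[of y "sup y z" x] by (simp add: sup_commute)
  finally show ?thesis
    by (simp add: ac_simps)
qed

lemma sup_gen_middle:
  "sup x (inf (sup x y) (inf (sup x z) (sup y z))) = inf (sup x y) (sup x z)"
proof -
  have "sup x (inf (sup y z) (inf (sup x y) (sup x z))) = inf (sup x (sup y z)) (inf (sup x y) (sup x z))"
    by (rule modular) simp
  also have "\<dots> = inf (sup x y) (sup x z)"
    by (intro inf_absorb2 le_infI1) (auto intro: le_supI1 le_supI2)
  finally show ?thesis
    by (simp add: ac_simps)
qed

definition fm :: "'a \<Rightarrow> 'a \<Rightarrow> 'a \<Rightarrow> 'a set" where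
  "fm x y z = fm_set (inf x (inf y z)) (inf (sup x y) (inf (sup x z) (sup y z)))
    (case_three_gens (inf y z) (inf x z) (inf x y))
    (case_three_gens (inf x (sup y z)) (inf y (sup x z)) (inf z (sup x y)))
    (case_three_gens x y z)"

lemma fm_sup_closed:
  assumes "u \<in> fm x y z" "v \<in> fm x y z"
  shows "sup u v \<in> fm x y z"
  unfolding fm_def
proof (rule fm_set_sup_closed[OF _ _ _ _ assms[unfolded fm_def]])
  fix g h :: three_gens
  show "inf x (inf y z) \<le> (case g of GenX \<Rightarrow> inf y z | GenY \<Rightarrow> inf x z | GenZ \<Rightarrow> inf x y)"
    by (cases g) (auto intro: le_infI1 le_infI2)
  show "(case g of GenX \<Rightarrow> inf x (sup y z) | GenY \<Rightarrow> inf y (sup x z) | GenZ \<Rightarrow> inf z (sup x y)) \<le>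
      (case g of GenX \<Rightarrow> x | GenY \<Rightarrow> y | GenZ \<Rightarrow> z)"
    by (cases g) auto
  show "(case h of GenX \<Rightarrow> inf y z | GenY \<Rightarrow> inf x z | GenZ \<Rightarrow> inf x y) \<le>
      (case g of GenX \<Rightarrow> inf x (sup y z) | GenY \<Rightarrow> inf y (sup x z) | GenZ \<Rightarrow> inf z (sup x y))"
    if "g \<noteq> h"
    using that by (cases g; cases h) (simp_all add: le_infI1 le_infI2 le_supI1 le_supI2)
  show "sup (case g of GenX \<Rightarrow> inf x (sup y z) | GenY \<Rightarrow> inf y (sup x z) | GenZ \<Rightarrow> inf z (sup x y))
      (case h of GenX \<Rightarrow> inf x (sup y z) | GenY \<Rightarrow> inf y (sup x z) | GenZ \<Rightarrow> inf z (sup x y)) =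
    inf (sup x y) (inf (sup x z) (sup y z))" if "g \<noteq> h"
    using that sup_middle[of x y z] sup_middle[of x z y] sup_middle[of y z x]
    by (cases g; cases h) (simp_all add: ac_simps)
qed

text \<open>The upper cube read from above: the upper median is the meet of all three pairwise
  joins, and by \<open>sup_gen_middle\<close> joining it with a generator removes the pairwise join
  of the other two.\<close>

lemma low_dual:
  "dual.low (sup x (sup y z)) (sup y z) (sup x z) (sup x y) P Q R =
    sup (inf (sup x y) (inf (sup x z) (sup y z))) (low (inf x (inf y z)) x y z (\<not> P) (\<not> Q) (\<not> R))"
proof -
  have "inf (opt E P A) (inf (opt E Q B) (opt E R C)) =
      sup t (sup (opt e (\<not> P) x) (sup (opt e (\<not> Q) y) (opt e (\<not> R) z)))"
    if "e \<le> x" "e \<le> y" "e \<le> z" "A \<le> E" "B \<le> E" "C \<le> E"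
      and "sup x y = C" "sup x z = B" "sup y z = A" "sup x A = E"
      and "inf A (inf B C) = t" "sup t x = inf B C" "sup t y = inf A C" "sup t z = inf A B"
      and t: "e \<le> t"
    for e t A B C E
  proof -
    have "t \<le> A" "t \<le> B" "t \<le> C"
      using that(11) by (metis inf_le1 inf_le2 inf_le2 order_trans)+
    then have "sup t A = A" "sup t B = B" "sup t C = C" "sup t E = E" "sup t e = t"
        "sup e A = A" "sup e B = B" "sup e C = C"
      using that(4) t by (meson order_trans sup_absorb1 sup_absorb2)+
    moreover have "sup e x = x" "sup e y = y" "sup e z = z" "sup x e = x" "sup y e = y" "sup z e = z"
      using that by (simp_all only: sup_absorb1 sup_absorb2)
    moreover have "inf E A = A" "inf E B = B" "inf E C = C" "inf A E = A" "inf B E = B" "inf C E = C"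
        "inf E (inf B C) = inf B C"
      using that by (simp_all add: inf_absorb1 inf_absorb2 le_infI1)
    moreover note that(7-14)
    ultimately show ?thesis
      by (cases P; cases Q; cases R) (simp_all only: opt_simps simp_thms sup_idem inf_idem)
  qed
  note * = this
  show ?thesis
    unfolding dual.low_def low_def
  proof (rule *)
    show "sup (inf (sup x y) (inf (sup x z) (sup y z))) x = inf (sup x z) (sup x y)"
      using sup_gen_middle[of x y z] by (simp only: ac_simps)
    show "sup (inf (sup x y) (inf (sup x z) (sup y z))) y = inf (sup y z) (sup x y)"
      using sup_gen_middle[of y x z] by (simp only: ac_simps)
    show "sup (inf (sup x y) (inf (sup x z) (sup y z))) z = inf (sup y z) (sup x z)"
      using sup_gen_middle[of z x y] by (simp only: ac_simps)
    show "inf (sup y z) (inf (sup x z) (sup x y)) = inf (sup x y) (inf (sup x z) (sup y z))"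
      by (simp only: ac_simps)
    show "inf x (inf y z) \<le> inf (sup x y) (inf (sup x z) (sup y z))"
      by (meson inf_le1 inf_le2 le_infI le_supI1 le_supI2 order_trans)
  qed (simp_all add: le_infI1 le_infI2 le_supI1 le_supI2)
qed

text \<open>A square read from above: its top is \<open>sup x (inf y z)\<close>; meeting it with
  \<open>sup y z\<close> drops \<open>x\<close>, and meeting it with \<open>x\<close> drops
  \<open>inf y z\<close>. Hence the flags are negated and swapped.\<close>

lemma mid_dual:
  "dual.mid (sup x (sup y z)) (sup x (inf y z)) (sup y z) x P Q =
    mid (inf x (inf y z)) (inf x (sup y z)) (inf y z) x (\<not> Q) (\<not> P)"
proof -
  have "inf m' (inf (opt E P A) (opt E Q x)) = sup m (sup (opt e (\<not> Q) a) (opt e (\<not> P) x))"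
    if "e \<le> a" "e \<le> x" "A \<le> E" "x \<le> E" "m' \<le> E" "e \<le> m"
      and m: "sup x a = m'" "inf x A = m" "inf m' A = sup m a"
    for e a A E m m'
  proof -
    have "sup m x = x" "inf m' x = x"
      using m by (metis inf_le1 sup_absorb2, metis sup_ge1 inf_absorb2)
    moreover have "sup m m' = m'"
      using m by (metis inf_le1 sup_ge1 order_trans sup_absorb2)
    moreover have "inf m' m = m"
      using calculation by (metis inf_absorb2 sup_ge1)
    moreover have "sup a x = m'" "inf A x = m"
      using m by (simp_all only: ac_simps)
    moreover have "sup e x = x" "sup e a = a" "sup a e = a" "sup m e = m"
      using that by (simp_all only: sup_absorb1 sup_absorb2)
    moreover have "inf E A = A" "inf E x = x" "inf A E = A" "inf m' E = m'"
      using that by (simp_all only: inf_absorb1 inf_absorb2)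
    moreover note m
    ultimately show ?thesis
      by (cases P; cases Q) (simp_all only: opt_simps simp_thms sup_idem inf_idem)
  qed
  note * = this
  show ?thesis
    unfolding dual.mid_def mid_def
  proof (rule *)
    have "inf (sup (inf y z) x) (sup y z) = sup (inf y z) (inf x (sup y z))"
      by (rule modular_sup) (simp add: le_infI1 le_supI1)
    then show "inf (sup x (inf y z)) (sup y z) = sup (inf x (sup y z)) (inf y z)"
      by (simp only: ac_simps)
  qed (simp_all add: le_infI1 le_infI2 le_supI1 le_supI2)
qed

end

text \<open>The context is reopened so that the interpretation also covers the facts proved above.\<close>

context modular_lattice
begin

interpretation dual: modular_lattice sup "(\<ge>)" "(>)" inf
  by (fact dual_modular)

text \<open>Duality exchanges the two cubes and maps each square to itself. Closure under meets then
  follows from closure under joins.\<close>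

lemma dual_fm: "dual.fm x y z = fm x y z"
proof -
  have up: "dual.lows (sup x (sup y z)) (sup y z) (sup x z) (sup x y) =
      sup (inf (sup x y) (inf (sup x z) (sup y z))) ` lows (inf x (inf y z)) x y z" for x y z
  proof -
    have "dual.lows (sup x (sup y z)) (sup y z) (sup x z) (sup x y) =
      {sup (inf (sup x y) (inf (sup x z) (sup y z))) (low (inf x (inf y z)) x y z P Q R) | P Q R. True}"
      unfolding dual.lows_def low_dual by (rule Collect_neg3)
    then show ?thesis
      unfolding lows_def image_Collect3 .
  qed
  \<comment> \<open>The identity for the upper cube, applied in the dual lattice, describes the
    lower cube.\<close>
  have down: "inf (sup (inf x y) (sup (inf x z) (inf y z))) ` dual.lows (sup x (sup y z)) x y z =
     lows (inf x (inf y z)) (inf y z) (inf x z) (inf x y)" for x y z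
  proof -
    have "lows (inf x (inf y z)) (inf y z) (inf x z) (inf x y) =
      {inf (sup (inf x y) (sup (inf x z) (inf y z))) (dual.low (sup x (sup y z)) x y z P Q R) | P Q R. True}"
      unfolding lows_def dual.low_dual by (rule Collect_neg3)
    then show ?thesis
      unfolding dual.lows_def image_Collect3 by (rule HOL.sym)
  qed
  have mid: "dual.mids (sup x (sup y z)) (sup x (inf y z)) (sup y z) x =
     mids (inf x (inf y z)) (inf x (sup y z)) (inf y z) x" for x y z
    unfolding dual.mids_def mids_def mid_dual by (rule Collect_neg_swap)
  have "dual.mids (sup x (sup y z)) (case_three_gens (sup x (inf y z)) (sup y (inf x z)) (sup z (inf x y)) g)
      (case_three_gens (sup y z) (sup x z) (sup x y) g) (case_three_gens x y z g) =
     mids (inf x (inf y z)) (case_three_gens (inf x (sup y z)) (inf y (sup x z)) (inf z (sup x y)) g)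
      (case_three_gens (inf y z) (inf x z) (inf x y) g) (case_three_gens x y z g)" for g
  proof -
    have "sup y (sup x z) = sup x (sup y z)" "sup z (sup x y) = sup x (sup y z)"
      "inf y (inf x z) = inf x (inf y z)" "inf z (inf x y) = inf x (inf y z)"
      by (simp_all only: ac_simps)
    then show ?thesis
      using mid[of x y z] mid[of y x z] mid[of z x y] by (cases g) simp_all
  qed
  then show ?thesis
    unfolding dual.fm_def fm_def dual.fm_set_def fm_set_def three_gens.case up down
    by (simp only: Un_ac)
qed

lemma fm_inf_closed: "u \<in> fm x y z \<Longrightarrow> v \<in> fm x y z \<Longrightarrow> inf u v \<in> fm x y z"
  using dual.fm_sup_closed[of u x y z v] unfolding dual_fm .

end

section \<open>The lattice \<open>m3\<close> and homomorphisms from free modular lattices\<close>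

datatype m3 = Bot | At three_gens | Top

instantiation m3 :: modular_lattice
begin

definition less_eq_m3 :: "m3 \<Rightarrow> m3 \<Rightarrow> bool" where
  "less_eq_m3 u v \<longleftrightarrow> u = Bot \<or> v = Top \<or> u = v"

definition less_m3 :: "m3 \<Rightarrow> m3 \<Rightarrow> bool" where
  "less_m3 u v \<longleftrightarrow> u \<le> v \<and> u \<noteq> v"

definition inf_m3 :: "m3 \<Rightarrow> m3 \<Rightarrow> m3" where
  "inf_m3 u v = (if u \<le> v then u else if v \<le> u then v else Bot)"

definition sup_m3 :: "m3 \<Rightarrow> m3 \<Rightarrow> m3" where
  "sup_m3 u v = (if u \<le> v then v else if v \<le> u then u else Top)"

instance
proof
  fix x y z :: m3
  note defs = less_eq_m3_def less_m3_def inf_m3_def sup_m3_def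
  show "(x < y) = (x \<le> y \<and> \<not> y \<le> x)" by (auto simp: defs)
  show "x \<le> x" by (auto simp: defs)
  show "x \<le> y \<Longrightarrow> y \<le> z \<Longrightarrow> x \<le> z" by (auto simp: defs)
  show "x \<le> y \<Longrightarrow> y \<le> x \<Longrightarrow> x = y" by (auto simp: defs)
  show "inf x y \<le> x" "inf x y \<le> y" "x \<le> y \<Longrightarrow> x \<le> z \<Longrightarrow> x \<le> inf y z"
    by (cases x; cases y; cases z; auto simp: defs)+
  show "x \<le> sup x y" "y \<le> sup x y" "y \<le> x \<Longrightarrow> z \<le> x \<Longrightarrow> sup y z \<le> x"
    by (cases x; cases y; cases z; auto simp: defs)+
  show "x \<le> z \<Longrightarrow> sup x (inf y z) = inf (sup x y) z"
    by (cases x; cases y; cases z; auto simp: defs)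
qed

end

instance set :: (type) modular_lattice
  by standard blast

definition fml_hom :: "('g \<Rightarrow> 'a::modular_lattice) \<Rightarrow> 'g free_modular_lattice \<Rightarrow> 'a" where
  "fml_hom f = (THE h. (\<forall>x y. h (inf x y) = inf (h x) (h y)) \<and> (\<forall>x y. h (sup x y) = sup (h x) (h y)) \<and>
    (\<forall>g. h (fml_gen g) = f g))"

lemma fml_hom_simps [simp]:
  "fml_hom f (inf u v) = inf (fml_hom f u) (fml_hom f v)"
  "fml_hom f (sup u v) = sup (fml_hom f u) (fml_hom f v)"
  "fml_hom f (fml_gen g) = f g"
  using theI'[OF free_modular_lattice_universal[of f]] unfolding fml_hom_def by blast+

lemma free_modular_lattice_induct [case_names gen inf sup]:
  assumes "\<And>g. P (fml_gen g)" "\<And>u v. P u \<Longrightarrow> P v \<Longrightarrow> P (inf u v)" "\<And>u v. P u \<Longrightarrow> P v \<Longrightarrow> P (sup u v)"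
  shows "P u"
proof (induction u)
  case (1 s)
  show ?case
    by (induction s)
      (use assms in \<open>simp_all flip: fml_gen.abs_eq inf_free_modular_lattice.abs_eq
        sup_free_modular_lattice.abs_eq\<close>)
qed

section \<open>The 28 elements of the free modular lattice and their order\<close>

abbreviation gen :: "three_gens \<Rightarrow> fm3" where
  "gen \<equiv> fml_gen"

definition bot3 :: fm3 where
  "bot3 = inf (gen GenX) (inf (gen GenY) (gen GenZ))"

definition mid3 :: fm3 where
  "mid3 = inf (sup (gen GenX) (gen GenY)) (inf (sup (gen GenX) (gen GenZ)) (sup (gen GenY) (gen GenZ)))"

text \<open>Indexed by the generator left out of the meet, so that joining \<open>atom3 g\<close> is
  a step of the square on the side of \<open>g\<close>.\<close>

definition atom3 :: "three_gens \<Rightarrow> fm3" where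
  "atom3 = case_three_gens (inf (gen GenY) (gen GenZ)) (inf (gen GenX) (gen GenZ)) (inf (gen GenX) (gen GenY))"

definition sub3 :: "three_gens \<Rightarrow> fm3" where
  "sub3 = case_three_gens (inf (gen GenX) (sup (gen GenY) (gen GenZ)))
    (inf (gen GenY) (sup (gen GenX) (gen GenZ))) (inf (gen GenZ) (sup (gen GenX) (gen GenY)))"

definition low3 :: "bool \<times> bool \<times> bool \<Rightarrow> fm3" where
  "low3 = (\<lambda>(P, Q, R). low bot3 (atom3 GenX) (atom3 GenY) (atom3 GenZ) P Q R)"

definition side3 :: "three_gens \<times> bool \<times> bool \<Rightarrow> fm3" where
  "side3 = (\<lambda>(g, P, Q). mid bot3 (sub3 g) (atom3 g) (gen g) P Q)"

definition up3 :: "bool \<times> bool \<times> bool \<Rightarrow> fm3" where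
  "up3 = (\<lambda>(P, Q, R). sup mid3 (low bot3 (gen GenX) (gen GenY) (gen GenZ) P Q R))"

lemma range_case_prod3: "range (\<lambda>(p, q, r). F p q r) = {F p q r | p q r. True}"
  unfolding full_SetCompr_eq[symmetric] split_paired_Ex by simp

lemma UN_Collect2: "(\<Union>p. {F p q r | q r. True}) = {F p q r | p q r. True}"
  by blast

text \<open>The normal forms contain the generators and are closed under both operations, so
  induction over terms reaches every element.\<close>

lemma UNIV_fm3: "UNIV = range low3 \<union> range side3 \<union> range up3"
proof -
  have gen: "case_three_gens (gen GenX) (gen GenY) (gen GenZ) = gen"
    by (rule ext) (simp split: three_gens.split)
  have fm: "fm (gen GenX) (gen GenY) (gen GenZ) = range low3 \<union> range side3 \<union> range up3"
    unfolding fm_def fm_set_def gen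
      bot3_def[symmetric] mid3_def[symmetric] atom3_def[symmetric] sub3_def[symmetric]
    by (simp only: lows_def mids_def low3_def side3_def up3_def range_case_prod3 image_Collect3 UN_Collect2)
  have "u \<in> fm (gen GenX) (gen GenY) (gen GenZ)" for u
  proof (induction u rule: free_modular_lattice_induct)
    case (gen g)
    have "bot3 \<le> gen g" "sub3 g \<le> gen g"
      by (cases g; simp add: bot3_def sub3_def le_infI1 le_infI2)+
    then have "gen g = side3 (g, False, True)"
      by (simp add: side3_def mid_def sup_absorb2)
    then show ?case
      unfolding fm by blast
  qed (rule fm_inf_closed fm_sup_closed; assumption)+
  with fm show ?thesis
    by blast
qed

text \<open>
  The elements of \<open>fm3\<close> are separated by their images in the lattice \<open>m3\<close> and in two Boolean
  lattices, which makes its order decidable.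
\<close>

definition h1 :: "fm3 \<Rightarrow> m3" where "h1 = fml_hom At"
definition h2 :: "fm3 \<Rightarrow> three_gens set" where "h2 = fml_hom (\<lambda>g. {g})"
definition h3 :: "fm3 \<Rightarrow> three_gens set" where "h3 = fml_hom (\<lambda>g. - {g})"

lemma h_simps [simp]:
  "h1 (inf u v) = inf (h1 u) (h1 v)" "h1 (sup u v) = sup (h1 u) (h1 v)" "h1 (gen g) = At g"
  "h2 (inf u v) = h2 u \<inter> h2 v" "h2 (sup u v) = h2 u \<union> h2 v" "h2 (gen g) = {g}"
  "h3 (inf u v) = h3 u \<inter> h3 v" "h3 (sup u v) = h3 u \<union> h3 v" "h3 (gen g) = - {g}"
  by (simp_all add: h1_def h2_def h3_def)

lemmas m3_defs = less_eq_m3_def less_m3_def inf_m3_def sup_m3_def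

lemma UNIV_three_gens: "UNIV = {GenX, GenY, GenZ}"
  using three_gens.exhaust by blast

instance three_gens :: finite
  by standard (simp add: UNIV_three_gens)

lemma h_elems [simp]:
  "h1 bot3 = Bot" "h2 bot3 = {}" "h3 bot3 = {}"
  "h1 (atom3 g) = Bot" "h2 (atom3 g) = {}" "h3 (atom3 g) = {g}"
  "h1 (sub3 g) = At g" "h2 (sub3 g) = {}" "h3 (sub3 g) = - {g}"
  "h1 mid3 = Top" "h2 mid3 = {}" "h3 mid3 = UNIV"
proof -
  have U: "z \<in> {GenX, GenY, GenZ}" for z
    using UNIV_three_gens by blast
  show "h1 bot3 = Bot" "h2 bot3 = {}" "h3 bot3 = {}"
    using U by (auto simp: bot3_def m3_defs)
  show "h1 mid3 = Top" "h2 mid3 = {}" "h3 mid3 = UNIV"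
    using U by (auto simp: mid3_def m3_defs)
  show "h1 (atom3 g) = Bot" "h2 (atom3 g) = {}" "h3 (atom3 g) = {g}"
    using U by (cases g; auto simp: atom3_def m3_defs)+
  show "h1 (sub3 g) = At g" "h2 (sub3 g) = {}" "h3 (sub3 g) = - {g}"
    using U by (cases g; auto simp: sub3_def m3_defs)+
qed

text \<open>\<open>h1\<close> tells the two cubes and the three sides apart. The flags are recovered
  by \<open>h3\<close> in the lower cube, by \<open>h2\<close> in the upper cube, and by one of each
  on a side.\<close>

lemma h_low3:
  "h1 (low3 (P, Q, R)) = Bot" "h2 (low3 (P, Q, R)) = {}"
  "GenX \<in> h3 (low3 (P, Q, R)) \<longleftrightarrow> P" "GenY \<in> h3 (low3 (P, Q, R)) \<longleftrightarrow> Q" "GenZ \<in> h3 (low3 (P, Q, R)) \<longleftrightarrow> R"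
  by (auto simp: low3_def low_def opt_def m3_defs)

lemma h_side3:
  "h1 (side3 (g, P, Q)) = At g" "h2 (side3 (g, P, Q)) = (if Q then {g} else {})"
  "h3 (side3 (g, P, Q)) = (if P then UNIV else - {g})"
  by (auto simp: side3_def mid_def opt_def m3_defs)

lemma h_up3:
  "h1 (up3 (P, Q, R)) = Top" "h3 (up3 (P, Q, R)) = UNIV"
  "GenX \<in> h2 (up3 (P, Q, R)) \<longleftrightarrow> P" "GenY \<in> h2 (up3 (P, Q, R)) \<longleftrightarrow> Q" "GenZ \<in> h2 (up3 (P, Q, R)) \<longleftrightarrow> R"
  by (auto simp: up3_def low_def opt_def m3_defs)

lemma h_inj:
  "h3 (low3 p) = h3 (low3 q) \<Longrightarrow> p = q" "h2 (up3 p) = h2 (up3 q) \<Longrightarrow> p = q"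
proof -
  have "p = (GenX \<in> h3 (low3 p), GenY \<in> h3 (low3 p), GenZ \<in> h3 (low3 p))" for p
    by (cases p) (simp add: h_low3)
  then show "h3 (low3 p) = h3 (low3 q) \<Longrightarrow> p = q"
    by metis
  have "p = (GenX \<in> h2 (up3 p), GenY \<in> h2 (up3 p), GenZ \<in> h2 (up3 p))" for p
    by (cases p) (simp add: h_up3)
  then show "h2 (up3 p) = h2 (up3 q) \<Longrightarrow> p = q"
    by metis
qed

lemma fm3_eqI:
  assumes "h1 u = h1 v" "h2 u = h2 v" "h3 u = h3 v"
  shows "u = v"
proof -
  have "w \<in> range low3 \<union> range side3 \<union> range up3" for w
    using UNIV_fm3 by blast
  from this[of u] this[of v] show ?thesis
    using assms by (auto simp: h_low3 h_side3 h_up3 split: if_splits dest!: h_inj)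
qed

lemma fm3_eq_iff: "u = v \<longleftrightarrow> h1 u = h1 v \<and> h2 u = h2 v \<and> h3 u = h3 v"
  using fm3_eqI by blast

lemma fm3_le_iff: "u \<le> v \<longleftrightarrow> h1 u \<le> h1 v \<and> h2 u \<subseteq> h2 v \<and> h3 u \<subseteq> h3 v"
  unfolding le_iff_inf fm3_eq_iff by auto

lemma fm3_less_iff: "u < v \<longleftrightarrow> u \<le> v \<and> (h1 u \<noteq> h1 v \<or> h2 u \<noteq> h2 v \<or> h3 u \<noteq> h3 v)"
  using fm3_eq_iff[of u v] by (auto simp: less_le)

lemma card_fm3: "card (UNIV :: fm3 set) = 28" "finite (UNIV :: fm3 set)"
proof -
  have inj: "inj low3" "inj side3" "inj up3"
    unfolding inj_on_def fm3_eq_iff using h_inj by (auto simp: h_side3 split: if_splits)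
  have card: "card (range low3) = 8" "card (range side3) = 12" "card (range up3) = 8"
    using inj by (simp_all add: card_image card_cartesian_product UNIV_three_gens flip: UNIV_Times_UNIV)
  have disj: "range low3 \<inter> range side3 = {}" "(range low3 \<union> range side3) \<inter> range up3 = {}"
    by (auto simp: fm3_eq_iff h_low3 h_side3 h_up3)
  show "finite (UNIV :: fm3 set)"
    unfolding UNIV_fm3 by simp
  show "card (UNIV :: fm3 set) = 28"
    unfolding UNIV_fm3 using disj card by (simp add: card_Un_disjoint)
qed

section \<open>Linear extensions and additive functions\<close>

text \<open>Along the total order the sets of predecessors grow strictly, since no element precedes
  itself. So positions are injective and below the cardinality, and counting gives the whole initial
  segment.\<close>

lemma linear_extension_position:
  fixes r :: "'a :: order rel"
  assumes fin: "finite (UNIV :: 'a set)" and r: "linear_extension UNIV (\<le>) r"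
  shows ext_position_strict_mono: "x < y \<Longrightarrow> ext_position r x < ext_position r y"
    and range_ext_position: "range (ext_position r) = {..<card (UNIV :: 'a set)}"
proof -
  have r': "trans r" "irrefl r" "total r" "\<And>x y. x < y \<Longrightarrow> (x, y) \<in> r"
    using r by (auto simp: linear_extension_def strict_linear_order_on_def less_le)
  have fin': "finite A" for A :: "'a set"
    by (rule finite_subset[OF subset_UNIV fin])
  have mono: "ext_position r x < ext_position r y" if "(x, y) \<in> r" for x y
    unfolding ext_position_def
  proof (rule psubset_card_mono)
    have "x \<notin> {p. (p, x) \<in> r}" "x \<in> {p. (p, y) \<in> r}"
      using r' that by (auto simp: irrefl_def)
    then show "{p. (p, x) \<in> r} \<subset> {p. (p, y) \<in> r}"
      using r'(1) that by (auto dest: transD)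
  qed (rule fin')
  show "x < y \<Longrightarrow> ext_position r x < ext_position r y"
    using mono r' by blast
  have "inj (ext_position r)"
  proof (rule injI, rule ccontr)
    fix x y assume "ext_position r x = ext_position r y" "x \<noteq> y"
    then show False
      using mono[of x y] mono[of y x] r'(3) by (auto simp: total_on_def)
  qed
  moreover have "ext_position r x < card (UNIV :: 'a set)" for x
    unfolding ext_position_def
  proof (rule psubset_card_mono[OF fin])
    have "x \<notin> {p. (p, x) \<in> r}"
      using r' by (auto simp: irrefl_def)
    then show "{p. (p, x) \<in> r} \<subset> UNIV" by blast
  qed
  ultimately show "range (ext_position r) = {..<card (UNIV :: 'a set)}"
    by (intro card_subset_eq) (auto simp: card_image)
qed

section \<open>Irreducible elements, concepts and additive functions\<close>

lemma join_irreducible_supD: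
  assumes "sup p q \<in> join_irreducibles"
  shows "sup p q = p \<or> sup p q = q"
proof (rule ccontr)
  assume "\<not> ?thesis"
  then have "p < sup p q" "q < sup p q"
    by (simp_all add: less_le) metis+
  moreover obtain s where s: "isLub UNIV {x. x < sup p q} s" "s < sup p q"
    using assms unfolding join_irreducibles_def by blast
  ultimately have "p \<le> s" "q \<le> s"
    by (auto simp: isLub_def leastP_def isUb_def setle_def)
  then show False
    using s(2) by (simp add: less_le_not_le)
qed

lemma meet_irreducible_infD:
  assumes "inf p q \<in> meet_irreducibles"
  shows "inf p q = p \<or> inf p q = q"
proof (rule ccontr)
  assume "\<not> ?thesis"
  then have "p > inf p q" "q > inf p q"
    by (simp_all add: less_le)
  moreover obtain s where s: "isGlb UNIV {x. x > inf p q} s" "inf p q < s"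
    using assms unfolding meet_irreducibles_def by blast
  ultimately have "s \<le> p" "s \<le> q"
    by (auto simp: isGlb_def greatestP_def isLb_def setge_def)
  then show False
    using s(2) by (simp add: less_le_not_le)
qed

lemma finite_lattice_isLub:
  fixes A :: "'a :: lattice set"
  assumes "finite A" "A \<noteq> {}"
  shows "isLub UNIV A (Sup_fin A)"
  using assms by (auto simp: isLub_def leastP_def isUb_def setle_def setge_def Sup_fin.coboundedI Sup_fin.boundedI)

lemma finite_lattice_isGlb:
  fixes A :: "'a :: lattice set"
  assumes "finite A" "A \<noteq> {}"
  shows "isGlb UNIV A (Inf_fin A)"
  using assms by (auto simp: isGlb_def greatestP_def isLb_def setle_def setge_def Inf_fin.coboundedI Inf_fin.boundedI)

text \<open>Induction on the number of elements below \<open>x\<close>: if \<open>x\<close> is not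
  join-irreducible, it is the join of its strict predecessors, and these lie below \<open>y\<close>
  by induction.\<close>

lemma le_if_join_irreducibles_le:
  fixes x y :: "'a :: lattice"
  assumes fin: "finite (UNIV :: 'a set)" and le: "\<And>j. j \<in> join_irreducibles \<Longrightarrow> j \<le> x \<Longrightarrow> j \<le> y"
  shows "x \<le> y"
proof -
  show ?thesis
    using le
  proof (induction "card {w. w < x}" arbitrary: x rule: less_induct)
    case (less x)
    have "card {v. v < w} < card {v. v < x}" if "w < x" for w
      using that by (intro psubset_card_mono finite_subset[OF subset_UNIV fin]) auto
    then have below: "w \<le> y" if "w < x" for w
      using less that by (meson less_imp_le order_trans)
    show ?case
    proof (cases "{w. w < x} = {}")
      case True
      \<comment> \<open>\<open>Sup_fin\<close> says nothing about the empty set, so an element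
        without strict predecessors is treated directly.\<close>
      have "inf x y = x"
        using True by (metis (mono_tags) empty_iff inf_le1 less_le mem_Collect_eq)
      then show ?thesis by (metis inf_le2)
    next
      case False
      have lub: "isLub UNIV {w. w < x} (Sup_fin {w. w < x})"
        by (rule finite_lattice_isLub[OF finite_subset[OF subset_UNIV fin] False])
      then have "Sup_fin {w. w < x} \<le> x" "Sup_fin {w. w < x} \<le> y"
        using below by (auto simp: isLub_def leastP_def isUb_def setle_def setge_def less_imp_le)
      moreover have "x \<in> join_irreducibles" if "Sup_fin {w. w < x} < x"
        using lub that unfolding join_irreducibles_def by blast
      ultimately show ?thesis
        using less.prems[of x] by (cases "Sup_fin {w. w < x} = x") (simp_all add: less_le)
    qed
  qed
qed

text \<open>Order dual of \<open>le_if_join_irreducibles_le\<close>.\<close>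

lemma le_if_le_meet_irreducibles:
  fixes x y :: "'a :: lattice"
  assumes fin: "finite (UNIV :: 'a set)" and le: "\<And>m. m \<in> meet_irreducibles \<Longrightarrow> y \<le> m \<Longrightarrow> x \<le> m"
  shows "x \<le> y"
proof -
  show ?thesis
    using le
  proof (induction "card {w. y < w}" arbitrary: y rule: less_induct)
    case (less y)
    have "card {v. w < v} < card {v. y < v}" if "y < w" for w
      using that by (intro psubset_card_mono finite_subset[OF subset_UNIV fin]) auto
    then have below: "x \<le> w" if "y < w" for w
      using less that by (meson less_imp_le order_trans)
    show ?case
    proof (cases "{w. y < w} = {}")
      case True
      have "sup x y = y"
        using True by (metis (mono_tags) empty_iff sup_ge2 less_le mem_Collect_eq)
      then show ?thesis by (metis sup_ge1)
    next
      case False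
      have glb: "isGlb UNIV {w. y < w} (Inf_fin {w. y < w})"
        by (rule finite_lattice_isGlb[OF finite_subset[OF subset_UNIV fin] False])
      then have "y \<le> Inf_fin {w. y < w}" "x \<le> Inf_fin {w. y < w}"
        using below by (auto simp: isGlb_def greatestP_def isLb_def setle_def setge_def less_imp_le)
      moreover have "y \<in> meet_irreducibles" if "y < Inf_fin {w. y < w}"
        using glb that unfolding meet_irreducibles_def by blast
      ultimately show ?thesis
        using less.prems[of y] by (cases "Inf_fin {w. y < w} = y") (simp_all add: less_le)
    qed
  qed
qed

lemma concept_of_in_concepts:
  fixes x :: "'a :: lattice"
  assumes fin: "finite (UNIV :: 'a set)"
  shows "concept_of x \<in> concepts (join_irreducibles :: 'a set) meet_irreducibles (\<le>)"
proof -
  have "x \<le> m" if "\<forall>j\<in>{j \<in> join_irreducibles. j \<le> x}. j \<le> m" for m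
    using that le_if_join_irreducibles_le[OF fin, where x = x and y = m] by blast
  moreover have "j \<le> x" if "\<forall>m\<in>{m \<in> meet_irreducibles. x \<le> m}. j \<le> m" for j
    using that le_if_le_meet_irreducibles[OF fin, where x = j and y = x] by blast
  ultimately show ?thesis
    unfolding concept_of_def concepts_def intent_of_def extent_of_def by (auto intro: order_trans)
qed

text \<open>
  A join-irreducible element that distributes over \<open>sup x y\<close> is below \<open>sup x y\<close> only if it is below
  \<open>x\<close> or \<open>y\<close>; so it is counted equally often on both sides, and dually for meet-irreducible ones.
\<close>

lemma additive_modular_pair:
  fixes v :: "'a :: lattice + 'a \<Rightarrow> real" and F :: "'a \<Rightarrow> real"
  assumes fin: "finite (UNIV :: 'a set)"
    and F: "\<And>x. F x = (\<Sum>s \<in> {j \<in> join_irreducibles. j \<le> x} <+> (meet_irreducibles - {m \<in> meet_irreducibles. x \<le> m}). v s)"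
    and inf: "\<And>j. inf j (sup x y) = sup (inf j x) (inf j y)"
    and sup: "\<And>m. sup m (inf x y) = inf (sup m x) (sup m y)"
  shows "F (sup x y) + F (inf x y) = F x + F y"
proof -
  have fin': "finite A" for A :: "'a set"
    by (rule finite_subset[OF subset_UNIV fin])
  \<comment> \<open>Indicator sums over all irreducible elements allow the identity to be checked
    one irreducible element at a time.\<close>
  let ?a = "\<lambda>u j. if j \<le> u then v (Inl j) else 0" and ?b = "\<lambda>u m. if \<not> u \<le> m then v (Inr m) else 0"
  have F': "F u = sum (?a u) join_irreducibles + sum (?b u) meet_irreducibles" for u
  proof -
    have "F u = (\<Sum>j | j \<in> join_irreducibles \<and> j \<le> u. v (Inl j)) +
        (\<Sum>m | m \<in> meet_irreducibles \<and> \<not> u \<le> m. v (Inr m))"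
      unfolding F by (subst sum.Plus) (auto simp: fin' intro!: sum.cong)
    then show ?thesis
      by (simp only: sum.inter_filter[OF fin'])
  qed
  have "?a (sup x y) j + ?a (inf x y) j = ?a x j + ?a y j" if "j \<in> join_irreducibles" for j
  proof -
    have "j \<le> x \<or> j \<le> y" if "j \<le> sup x y"
    proof -
      have "sup (inf j x) (inf j y) = j"
        using inf[of j] that by (simp add: inf_absorb1)
      then show ?thesis
        using join_irreducible_supD[of "inf j x" "inf j y"] \<open>j \<in> join_irreducibles\<close>
        by (metis inf_le2)
    qed
    then show ?thesis
      by (auto intro: le_supI1 le_supI2)
  qed
  moreover have "?b (sup x y) m + ?b (inf x y) m = ?b x m + ?b y m" if "m \<in> meet_irreducibles" for m
  proof -
    have "x \<le> m \<or> y \<le> m" if "inf x y \<le> m"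
    proof -
      have "inf (sup m x) (sup m y) = m"
        using sup[of m] that by (simp add: sup_absorb1)
      then show ?thesis
        using meet_irreducible_infD[of "sup m x" "sup m y"] \<open>m \<in> meet_irreducibles\<close>
        by (metis sup_ge2)
    qed
    then show ?thesis
      by (auto intro: le_infI1 le_infI2)
  qed
  ultimately have "(\<Sum>j\<in>join_irreducibles. ?a (sup x y) j + ?a (inf x y) j) = (\<Sum>j\<in>join_irreducibles. ?a x j + ?a y j)"
    "(\<Sum>m\<in>meet_irreducibles. ?b (sup x y) m + ?b (inf x y) m) = (\<Sum>m\<in>meet_irreducibles. ?b x m + ?b y m)"
    by (simp_all cong: sum.cong)
  then show ?thesis
    unfolding F' sum.distrib by linarith
qed

section \<open>Additive numberings\<close>

text \<open>The modular identity determines \<open>f\<close> by nine numbers, the steps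
  \<open>p\<close> and \<open>q\<close> and the side bottoms \<open>s\<close>, so that its values
  form a \<open>tiling\<close>.\<close>

lemma no_modular_numbering:
  fixes f :: "fm3 \<Rightarrow> int"
  assumes mono: "\<And>u v. u < v \<Longrightarrow> f u < f v" and range: "range f = {0..27}"
    and modular: "\<And>u v. h1 u \<le> h1 v \<Longrightarrow> f (sup u v) + f (inf u v) = f u + f v"
  shows False
proof -
  define top where "top = up3 (True, True, True)"
  have bot: "bot3 \<le> u" for u
    by (simp add: fm3_le_iff less_eq_m3_def)
  have top: "u \<le> top" for u
  proof -
    have "g \<in> h2 top" for g
      by (cases g) (simp_all add: top_def h_up3)
    then have "h1 top = Top" "h2 top = UNIV" "h3 top = UNIV"
      by (auto simp: top_def h_up3)
    then show ?thesis
      by (simp add: fm3_le_iff less_eq_m3_def)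
  qed
  have mono': "f u \<le> f v" if "u \<le> v" for u v
    using that mono[of u v] by (cases "u = v") (simp_all add: less_le)
  have f_bot: "f bot3 = 0"
  proof -
    obtain u where "f u = 0" using range by (metis atLeastAtMost_iff order.refl rangeE zero_le_numeral)
    moreover have "0 \<le> f bot3" using range by auto
    ultimately show ?thesis using mono'[OF bot, of u] by simp
  qed
  have f_top: "f top = 27"
  proof -
    obtain u where "f u = 27" using range by (metis atLeastAtMost_iff order.refl rangeE zero_le_numeral)
    moreover have "f top \<le> 27" using range by auto
    ultimately show ?thesis using mono'[OF top, of u] by simp
  qed
  define p where "p g = f (atom3 g)" for g
  define s where "s g = f (sub3 g)" for g
  define q where "q g = f (gen g) - f (sub3 g)" for g
  \<comment> \<open>Joining \<open>v\<close> to \<open>u\<close> raises \<open>f\<close> by its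
    increment from \<open>inf v u\<close> to \<open>v\<close>; an absent joinand is
    \<open>bot3\<close> and changes nothing.\<close>
  have add: "f (sup (opt bot3 P v) u) = f u + (if P then f v - f w else 0)"
    if "h1 v \<le> h1 u" "inf v u = w" for P u v w
    using modular[OF that(1)] that(2) bot[of u] by (simp add: opt_def sup_absorb2)
  have low: "f (low3 (P, Q, R)) =
      (if P then p GenX else 0) + (if Q then p GenY else 0) + (if R then p GenZ else 0)" for P Q R
  proof -
    have "f (opt bot3 R (atom3 GenZ)) = (if R then p GenZ else 0)"
      by (simp add: opt_def p_def f_bot)
    moreover have "f (sup (opt bot3 Q (atom3 GenY)) (opt bot3 R (atom3 GenZ))) =
        f (opt bot3 R (atom3 GenZ)) + (if Q then f (atom3 GenY) - f bot3 else 0)"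
      by (rule add) (auto simp: opt_def fm3_eq_iff m3_defs)
    moreover have "f (sup (opt bot3 P (atom3 GenX)) (sup (opt bot3 Q (atom3 GenY)) (opt bot3 R (atom3 GenZ)))) =
        f (sup (opt bot3 Q (atom3 GenY)) (opt bot3 R (atom3 GenZ))) + (if P then f (atom3 GenX) - f bot3 else 0)"
      by (rule add) (auto simp: opt_def fm3_eq_iff m3_defs)
    ultimately show ?thesis
      by (simp add: low3_def low_def p_def f_bot)
  qed
  \<comment> \<open>On its own side \<open>atom3 g\<close> still meets the other joinands in
    \<open>bot3\<close>, so its step is the same \<open>p g\<close> as in the lower cube.\<close>
  have side: "f (side3 (g, P, Q)) = s g + (if P then p g else 0) + (if Q then q g else 0)" for g P Q
  proof -
    have "f (sup (opt bot3 Q (gen g)) (sub3 g)) = f (sub3 g) + (if Q then f (gen g) - f (sub3 g) else 0)"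
      by (rule add) (auto simp: opt_def fm3_eq_iff m3_defs)
    moreover have "f (sup (opt bot3 P (atom3 g)) (sup (opt bot3 Q (gen g)) (sub3 g))) =
        f (sup (opt bot3 Q (gen g)) (sub3 g)) + (if P then f (atom3 g) - f bot3 else 0)"
      by (rule add) (auto simp: opt_def fm3_eq_iff m3_defs)
    moreover have "side3 (g, P, Q) = sup (opt bot3 P (atom3 g)) (sup (opt bot3 Q (gen g)) (sub3 g))"
      by (simp add: side3_def mid_def ac_simps)
    ultimately show ?thesis
      by (simp add: p_def q_def s_def f_bot)
  qed
  \<comment> \<open>A generator meets \<open>mid3\<close>, even when joined with other generators,
    in its own \<open>sub3\<close>; so its step is always its \<open>q\<close>.\<close>
  have up: "f (up3 (P, Q, R)) = f mid3 +
      (if P then q GenX else 0) + (if Q then q GenY else 0) + (if R then q GenZ else 0)" for P Q R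
  proof -
    let ?u = "sup (opt bot3 R (gen GenZ)) mid3"
    have "f ?u = f mid3 + (if R then f (gen GenZ) - f (sub3 GenZ) else 0)"
      by (rule add) (auto simp: opt_def fm3_eq_iff m3_defs)
    moreover have "f (sup (opt bot3 Q (gen GenY)) ?u) =
        f ?u + (if Q then f (gen GenY) - f (sub3 GenY) else 0)"
      by (rule add) (auto simp: opt_def fm3_eq_iff m3_defs)
    moreover have "f (sup (opt bot3 P (gen GenX)) (sup (opt bot3 Q (gen GenY)) ?u)) =
        f (sup (opt bot3 Q (gen GenY)) ?u) + (if P then f (gen GenX) - f (sub3 GenX) else 0)"
      by (rule add) (auto simp: opt_def fm3_eq_iff m3_defs)
    moreover have "up3 (P, Q, R) = sup (opt bot3 P (gen GenX)) (sup (opt bot3 Q (gen GenY)) ?u)"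
      by (simp add: up3_def low_def ac_simps)
    ultimately show ?thesis
      by (simp add: q_def)
  qed
  have mid: "f mid3 = 27 - q GenX - q GenY - q GenZ"
    using f_top up[of True True True] by (simp add: top_def)
  have pair: "p g + p h < s k" if "g \<noteq> h" "g \<noteq> k" "h \<noteq> k" for g h k
  proof -
    have "inf (atom3 g) (atom3 h) = bot3"
      using that by (simp add: fm3_eq_iff m3_defs)
    then have "f (sup (atom3 g) (atom3 h)) = p g + p h"
      using modular[of "atom3 g" "atom3 h"] by (simp add: p_def f_bot)
    moreover have "sup (atom3 g) (atom3 h) < sub3 k"
      using that by (auto simp: fm3_less_iff fm3_le_iff m3_defs)
    ultimately show ?thesis
      using mono unfolding s_def by metis
  qed
  have below_mid: "s g + p g < 27 - q GenX - q GenY - q GenZ" for g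
  proof -
    have "side3 (g, True, False) < mid3"
      by (simp add: h_side3 fm3_less_iff fm3_le_iff m3_defs)
    from mono[OF this] show ?thesis
      by (simp add: side mid)
  qed
  have p_pos: "0 < p g" for g
  proof -
    have "bot3 < atom3 g" by (simp add: fm3_less_iff fm3_le_iff m3_defs)
    from mono[OF this] show ?thesis by (simp add: f_bot p_def)
  qed
  have q_pos: "0 < q g" for g
  proof -
    have "sub3 g < gen g" by (simp add: fm3_less_iff fm3_le_iff m3_defs)
    from mono[OF this] show ?thesis by (simp add: q_def)
  qed
  let ?L = "tiling (p GenX, p GenY, p GenZ) (q GenX, q GenY, q GenZ) (s GenX, s GenY, s GenZ)"
  note tiling_defs = tiling_def tile_def cube_def
  have "f u \<in> set ?L" for u
  proof -
    have "u \<in> range low3 \<union> range side3 \<union> range up3"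
      using UNIV_fm3 by blast
    then consider P Q R where "u = low3 (P, Q, R)" | g P Q where "u = side3 (g, P, Q)"
      | P Q R where "u = up3 (P, Q, R)"
      by auto
    then show ?thesis
    proof cases
      case (1 P Q R)
      have "f u \<in> set (cube (p GenX) (p GenY) (p GenZ))"
        unfolding 1 low by (cases P; cases Q; cases R) (simp_all add: tiling_defs)
      then show ?thesis by (simp add: tiling_def)
    next
      case (2 g P Q)
      have "f u \<in> set (tile (p g) (q g) (s g))"
        unfolding 2 side by (cases P; cases Q) (simp_all add: tiling_defs)
      then show ?thesis by (cases g) (simp_all add: tiling_def)
    next
      case (3 P Q R)
      \<comment> \<open>Counted down from 27, the generators with false flags contribute their
        \<open>q\<close>.\<close>
      have "27 - f u \<in> set (cube (q GenX) (q GenY) (q GenZ))"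
        unfolding 3 up mid by (cases P; cases Q; cases R) (simp_all add: tiling_defs)
      then have "f u \<in> (\<lambda>v. 27 - v) ` set (cube (q GenX) (q GenY) (q GenZ))"
        by (rule rev_image_eqI) simp
      then show ?thesis by (simp add: tiling_def)
    qed
  qed
  then have "{0..27} \<subseteq> set ?L"
    unfolding range[symmetric] by (rule image_subsetI)
  then show False
    by (rule no_tiling) (simp_all add: p_pos q_pos pair below_mid)
qed

theorem theorem2:
  fixes d :: nat
  assumes "d = order_dim (UNIV :: fm3 set) (\<le>)"
  shows "reLD d (UNIV :: fm3 set) (\<le>) \<inter>
    (\<lambda>pos. pos \<circ> concept_of) `
      AddLD d (join_irreducibles :: fm3 set) (meet_irreducibles :: fm3 set) (\<le>) = {}"
proof (rule ccontr)
  let ?J = "join_irreducibles :: fm3 set" and ?M = "meet_irreducibles :: fm3 set"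
  assume "\<not> ?thesis"
  then obtain pos where re: "pos \<circ> concept_of \<in> reLD d (UNIV :: fm3 set) (\<le>)"
    and add: "pos \<in> AddLD d ?J ?M (\<le>)"
    by blast
  from re obtain rs :: "nat \<Rightarrow> fm3 rel" where rs: "realizer UNIV (\<le>) (rs ` {..<d})"
    and pos: "\<And>c i. i < d \<Longrightarrow> pos (concept_of c) i = real (ext_position (rs i) c)"
    unfolding reLD_def by auto
  \<comment> \<open>The intersection of an empty family is \<open>UNIV\<close>, which contains the
    reflexive pair \<open>(bot3, bot3)\<close>.\<close>
  have "d \<noteq> 0"
  proof
    assume "d = 0"
    then have "(bot3, bot3) \<in> {(p, q). p \<in> UNIV \<and> q \<in> UNIV \<and> p \<le> q \<and> p \<noteq> q}"
      using rs unfolding realizer_def by auto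
    then show False by simp
  qed
  then have d: "0 < d" by simp
  then have ext: "linear_extension UNIV (\<le>) (rs 0)"
    using rs unfolding realizer_def by blast
  from add obtain vec where vec: "\<forall>(A, B) \<in> concepts ?J ?M (\<le>). \<forall>i<d.
      pos (A, B) i = (\<Sum>s \<in> A <+> (?M - B). vec s i)"
    unfolding AddLD_def by blast
  define F where "F c = real (ext_position (rs 0) c)" for c
  have F: "F c = (\<Sum>s \<in> {j \<in> ?J. j \<le> c} <+> (?M - {m \<in> ?M. c \<le> m}). vec s 0)" for c
  proof -
    have "pos (concept_of c) 0 = (\<Sum>s \<in> {j \<in> ?J. j \<le> c} <+> (?M - {m \<in> ?M. c \<le> m}). vec s 0)"
      using bspec[OF vec concept_of_in_concepts[OF card_fm3(2), of c]] d by (simp add: concept_of_def)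
    then show ?thesis using pos[OF d] by (simp add: F_def)
  qed
  \<comment> \<open>The positions of \<open>F\<close> again, now as integers: additive sums are
    real, while the search for tilings is over the integers.\<close>
  define f where "f c = int (ext_position (rs 0) c)" for c
  show False
  proof (rule no_modular_numbering)
    show "f u < f v" if "u < v" for u v
      using ext_position_strict_mono[OF card_fm3(2) ext that] by (simp add: f_def)
    have "range f = int ` range (ext_position (rs 0))"
      unfolding f_def by blast
    also have "\<dots> = {0..27}"
      unfolding range_ext_position[OF card_fm3(2) ext] card_fm3(1)
      by (auto simp: image_iff intro!: bexI[of _ "nat _"])
    finally show "range f = {0..27}" .
    show "f (sup u v) + f (inf u v) = f u + f v" if "h1 u \<le> h1 v" for u v
    proof -
      have "F (sup u v) + F (inf u v) = F u + F v"
      proof (rule additive_modular_pair[OF card_fm3(2) F])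
        fix w
        \<comment> \<open>A comparable pair distributes in \<open>m3\<close>, and every pair does in
          the two Boolean lattices. As the three homomorphisms separate elements, both laws lift to
          \<open>fm3\<close>.\<close>
        have "inf (h1 w) (sup (h1 u) (h1 v)) = sup (inf (h1 w) (h1 u)) (inf (h1 w) (h1 v))"
          "sup (h1 w) (inf (h1 u) (h1 v)) = inf (sup (h1 w) (h1 u)) (sup (h1 w) (h1 v))"
          using that inf_mono[OF order_refl that, of "h1 w"] sup_mono[OF order_refl that, of "h1 w"]
          by (simp_all add: sup_absorb2 inf_absorb1)
        then show "inf w (sup u v) = sup (inf w u) (inf w v)" "sup w (inf u v) = inf (sup w u) (sup w v)"
          by (auto simp: fm3_eq_iff)
      qed
      then show ?thesis
        unfolding F_def f_def by linarith
    qed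
  qed
qed

end
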